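(* Let $0<\alpha\le 1$ and let $\{\mathcal{N}^{\alpha}_{c}(t)\}_{t\ge 0}$ be the convoluted fractional Poisson process with intensity parameters $\{\lambda_j\}_{j\in\mathbb{Z}}$ (so $\lambda_{-1}=0$). Then its probability generating function $G^{\alpha}_{c}(u,t)=\mathbb{E}\big(u^{\mathcal{N}^{\alpha}_{c}(t)}\big)$ is given, for $t\ge 0$, by $$G^{\alpha}_{c}(u,t)=E_{\alpha,1}\left(\sum_{j=0}^{\infty}u^{j}(\lambda_{j-1}-\lambda_{j})t^{\alpha}\right),\qquad |u|\le 1.$$
   Context: $\mathbb{N}_0$ denotes the non-negative integers; $0^0=1$. Mittag-Leffler function: $E_{\alpha,1}(x)=\sum_{k=0}^\infty \frac{x^k}{\Gamma(k\alpha+1)}$. Intensity parameters: $\{\lambda_j\}_{j\in\mathbb{Z}}$ are real numbers with $\lambda_j=0$ for $j<0$, $\lambda_0>0$, $\lambda_j\ge 0$ for $j>0$, non-increasing for $j\ge 0$, and $\lim_{j\to\infty}\lambda_{j+1}/\lambda_j<1$ (this limit condition is regarded as satisfied if $\lambda_j=0$ for all large $j$). Fractional derivative (Dzhrbashyan–Caputo): $\partial_t^{\alpha}f(t)=\frac{1}{\Gamma(1-\alpha)}\int_0^t (t-s)^{-\alpha}f'(s)\,\mathrm{d}s$ for $0<\alpha<1$, and $\partial_t^{1}f(t)=f'(t)$. Convoluted fractional Poisson process (CFPP): an $\mathbb{N}_0$-valued stochastic process $\{\mathcal{N}^{\alpha}_{c}(t)\}_{t\ge0}$ whose state probabilities $p^{\alpha}_{c}(n,t)=\Pr\{\mathcal{N}^{\alpha}_{c}(t)=n\}$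 satisfy, for all $n\ge 0$, $$\partial_t^{\alpha}p^{\alpha}_{c}(n,t)=-\lambda_n * p^{\alpha}_{c}(n,t)+\lambda_{n-1}*p^{\alpha}_{c}(n-1,t),$$ where $\lambda_n*p^{\alpha}_{c}(n,t)=\sum_{j=-\infty}^{\infty}\lambda_j p^{\alpha}_{c}(n-j,t)$ is the discrete convolution in the space variable, with $p^{\alpha}_{c}(0,0)=1$, $p^{\alpha}_{c}(n,0)=0$ for $n\ge 1$, and $p^{\alpha}_{c}(-n,t)=0$ for $n\ge 1$, $t\ge 0$. Equivalently, $\partial_t^{\alpha}p^{\alpha}_{c}(n,t)=-\lambda_0 p^{\alpha}_{c}(n,t)+\sum_{j=1}^{n}(\lambda_{j-1}-\lambda_j)p^{\alpha}_{c}(n-j,t)$. *)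

theory Defs
  imports "HOL-Probability.Probability"
begin

definition mittag_leffler :: "real \<Rightarrow> real \<Rightarrow> complex \<Rightarrow> complex" where
  "mittag_leffler \<alpha> \<beta> x = (\<Sum>k. x ^ k / of_real (Gamma (of_nat k * \<alpha> + \<beta>)))"

text \<open>
  The Dzhrbashyan--Caputo derivative of order \<open>0 < \<alpha> \<le> 1\<close>, with a Lebesgue integral.
  Since \<^const>\<open>deriv\<close> and the integral are total, the formula is only meaningful together
  with \<open>caputo_differentiable\<close> below.
\<close>

definition caputo_deriv :: "real \<Rightarrow> (real \<Rightarrow> real) \<Rightarrow> real \<Rightarrow> real" where
  "caputo_deriv \<alpha> f t =
     (if \<alpha> = 1 then deriv f t
      else 1 / Gamma (1 - \<alpha>) * (LBINT s:{0<..<t}. (t - s) powr (- \<alpha>) * deriv f s))"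

text \<open>
  The functions on \<open>[0, \<infinity>)\<close> to which the operator is applied.  Nothing is required of the
  derivative at \<open>0\<close>: the solutions of fractional equations typically behave like
  \<open>t powr \<alpha>\<close> there.  Continuity at \<open>0\<close> has to be demanded, because the values of \<open>f'\<close> on
  \<open>(0, \<infinity>)\<close> do not see \<open>f 0\<close>, so that otherwise an initial condition would have no
  bearing on the solution.
\<close>

definition caputo_differentiable :: "real \<Rightarrow> (real \<Rightarrow> real) \<Rightarrow> bool" where
  "caputo_differentiable \<alpha> f \<longleftrightarrow>
     continuous_on {0..} f \<and>
     (\<forall>t>0. f differentiable (at t)) \<and>
     (\<alpha> < 1 \<longrightarrow> (\<forall>t>0. set_integrable lborel {0<..<t} (\<lambda>s. (t - s) powr (- \<alpha>) * deriv f s)))"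

definition discrete_conv :: "(int \<Rightarrow> real) \<Rightarrow> (int \<Rightarrow> real) \<Rightarrow> int \<Rightarrow> real" where
  "discrete_conv a b n = (\<Sum>\<^sub>\<infinity>j\<in>UNIV. a j * b (n - j))"

text \<open>
  In the limit condition, \<open>x / 0 = 0\<close> makes the ratio eventually \<open>0\<close> when the intensities
  vanish from some index on, so that this case is covered with limit \<open>0\<close>.
\<close>

locale intensity_parameters =
  fixes lam :: "int \<Rightarrow> real"
  assumes lam_neg: "\<And>j. j < 0 \<Longrightarrow> lam j = 0"
    and lam_0: "lam 0 > 0"
    and lam_pos: "\<And>j. j > 0 \<Longrightarrow> lam j \<ge> 0"
    and lam_decreasing: "\<And>i j. 0 \<le> i \<Longrightarrow> i \<le> j \<Longrightarrow> lam j \<le> lam i"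
    and lam_ratio: "\<exists>L<1. (\<lambda>k::nat. lam (int k + 1) / lam (int k)) \<longlonglongrightarrow> L"

text \<open>
  States are indexed by \<open>int\<close>, so that the probabilities of negative states are \<open>0\<close>.
\<close>

definition state_prob :: "'a measure \<Rightarrow> (real \<Rightarrow> 'a \<Rightarrow> nat) \<Rightarrow> int \<Rightarrow> real \<Rightarrow> real" where
  "state_prob M N n t = measure M {\<omega> \<in> space M. int (N t \<omega>) = n}"

text \<open>
  Only the values \<open>N t\<close> for \<open>t \<ge> 0\<close> matter.  The governing equations are imposed for
  \<open>t > 0\<close>: for \<open>\<alpha> < 1\<close> the integral defining the derivative is \<open>0\<close> at \<open>t = 0\<close>, whereas the
  right-hand side for \<open>n = 0\<close> is \<open>- lam 0 < 0\<close> there.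
\<close>

locale convoluted_fractional_poisson =
  prob_space M + intensity_parameters lam
  for M :: "'a measure" and lam :: "int \<Rightarrow> real" +
  fixes \<alpha> :: real and N :: "real \<Rightarrow> 'a \<Rightarrow> nat"
  assumes measurable_N: "\<And>t. t \<ge> 0 \<Longrightarrow> N t \<in> measurable M (count_space UNIV)"
    and initial_0: "state_prob M N 0 0 = 1"
    and initial_pos: "\<And>n. n \<ge> 1 \<Longrightarrow> state_prob M N n 0 = 0"
    and differentiable: "\<And>n. n \<ge> 0 \<Longrightarrow> caputo_differentiable \<alpha> (state_prob M N n)"
    and governing: "\<And>n t. n \<ge> 0 \<Longrightarrow> t > 0 \<Longrightarrow>
      caputo_deriv \<alpha> (state_prob M N n) t =
        - discrete_conv lam (\<lambda>m. state_prob M N m t) n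
        + discrete_conv lam (\<lambda>m. state_prob M N m t) (n - 1)"

definition prob_gen_fun :: "'a measure \<Rightarrow> ('a \<Rightarrow> nat) \<Rightarrow> complex \<Rightarrow> complex" where
  "prob_gen_fun M X u = (\<integral>\<omega>. u ^ X \<omega> \<partial>M)"

end

theory Submission
  imports Defs
begin

text \<open>
  Applying the Riemann--Liouville integral of order \<open>\<alpha>\<close> to the governing equations turns
  them into Volterra equations, which sum to
  \<open>G t - 1 = z / \<Gamma>(\<alpha>) * (\<integral>s\<in>{0<..<t}. (t - s) powr (\<alpha> - 1) * G s)\<close> for the generating function \<open>G\<close>,
  where \<open>z = (\<Sum>j. u ^ j * (lam (j - 1) - lam j))\<close>. Iterating this equation \<open>K\<close> times produces the first
  \<open>K\<close> terms of the Mittag-Leffler series; since \<open>norm (G t) \<le> 1\<close>, the remainder is at most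
  \<open>norm z ^ K * t powr (K * \<alpha>) / \<Gamma>(K * \<alpha> + 1)\<close>, which tends to \<open>0\<close>.
\<close>

subsection \<open>The Gamma function grows faster than any exponential\<close>

text \<open>Keep only the part of the Euler integral over \<open>{R..}\<close>: there
  \<open>t powr (x - 1)\<close> is at least \<open>R powr (x - 1)\<close>, because
  \<open>x - 1\<close> is nonnegative, and the remaining exponential integrates to
  \<open>exp (- R)\<close>.\<close>

lemma Gamma_ge_powr_mult_exp:
  fixes x R :: real
  assumes "x \<ge> 1" "R > 0"
  shows "R powr (x - 1) * exp (- R) \<le> Gamma x"
proof (rule has_integral_le)
  show "((\<lambda>t. if t \<in> {R..} then R powr (x - 1) * exp (- t) else 0) has_integral R powr (x - 1) * exp (- R)) {0..}"
    using has_integral_mult_right[OF has_integral_exp_minus_to_infinity[of 1 R], of "R powr (x - 1)"] assms(2)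
    by (subst has_integral_restrict) auto
  show "((\<lambda>t. t powr (x - 1) / exp t) has_integral Gamma x) {0..}"
    by (rule Gamma_integral_real) (use assms in simp)
  show "(if t \<in> {R..} then R powr (x - 1) * exp (- t) else 0) \<le> t powr (x - 1) / exp t" for t
    using assms by (auto simp: exp_minus field_simps intro!: powr_mono2)
qed

lemma power_over_Gamma_tendsto_0:
  fixes x \<alpha> :: real
  assumes "\<alpha> > 0" "x \<ge> 0"
  shows "(\<lambda>k. x ^ k / Gamma (real k * \<alpha> + 1)) \<longlonglongrightarrow> 0"
proof -
  \<comment> \<open>This choice makes \<open>R powr (k * \<alpha>)\<close> equal to
    \<open>(x + 1) ^ k\<close>, so the Gamma bound dominates the quotient by a geometric sequence of
    ratio \<open>x / (x + 1) < 1\<close>.\<close>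
  define R where "R = (x + 1) powr (1 / \<alpha>)"
  have R: "R > 0" "R powr \<alpha> = x + 1"
    using assms by (auto simp: R_def powr_powr)
  have pow: "R powr (real k * \<alpha>) = (x + 1) ^ k" for k
    using R by (simp add: mult.commute[of _ \<alpha>] powr_powr[symmetric] powr_realpow assms(2) add_nonneg_pos)
  have lim: "(\<lambda>k. exp R * (x / (x + 1)) ^ k) \<longlonglongrightarrow> exp R * 0"
    using assms by (intro tendsto_mult tendsto_const LIMSEQ_power_zero) auto
  have bound: "norm (x ^ k / Gamma (real k * \<alpha> + 1)) \<le> exp R * (x / (x + 1)) ^ k" for k
  proof -
    have pos: "0 < real k * \<alpha> + 1"
      using assms by (simp add: add_nonneg_pos)
    have "(x + 1) ^ k * exp (- R) \<le> Gamma (real k * \<alpha> + 1)"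
      using Gamma_ge_powr_mult_exp[of "real k * \<alpha> + 1" R] R assms pow by simp
    then have "x ^ k / Gamma (real k * \<alpha> + 1) \<le> x ^ k / ((x + 1) ^ k * exp (- R))"
      using assms by (intro divide_left_mono mult_pos_pos Gamma_real_pos) (auto intro: add_nonneg_pos)
    then show ?thesis
      using assms Gamma_real_pos[OF pos]
      by (simp add: power_divide exp_minus field_simps)
  qed
  show ?thesis
    by (rule Lim_null_comparison[OF always_eventually[OF allI[OF bound]] lim[unfolded mult_zero_right]])
qed

subsection \<open>The Riemann--Liouville kernel\<close>

text \<open>Integration against this kernel is the Riemann-Liouville integral of order \<alpha>,
  written I^\<alpha> below. With the indicator built in, all integrals run over the whole line,
  which suits Fubini.\<close>

definition rl_kernel :: "real \<Rightarrow> real \<Rightarrow> real \<Rightarrow> real" where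
  "rl_kernel \<alpha> t s = indicator {0<..<t} s * (t - s) powr (\<alpha> - 1) / Gamma \<alpha>"

lemma rl_kernel_nonneg: "\<alpha> > 0 \<Longrightarrow> 0 \<le> rl_kernel \<alpha> t s"
  by (simp add: rl_kernel_def)

lemma rl_kernel_eq_0: "s \<notin> {0<..<t} \<Longrightarrow> rl_kernel \<alpha> t s = 0"
  by (simp add: rl_kernel_def)

lemma rl_kernel_1: "rl_kernel 1 t s = indicator {0<..<t} s"
  by (auto simp: rl_kernel_def indicator_def)

text \<open>Composing with \<open>f\<close> and \<open>g\<close> gives joint measurability in both
  arguments, as Fubini requires.\<close>

lemma rl_kernel_measurable [measurable]:
  assumes [measurable]: "f \<in> borel_measurable M" "g \<in> borel_measurable M"
  shows "(\<lambda>x. rl_kernel \<alpha> (f x) (g x)) \<in> borel_measurable M"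
proof -
  have "(\<lambda>x. rl_kernel \<alpha> (f x) (g x)) =
      (\<lambda>x. (if 0 < g x \<and> g x < f x then 1 else 0) * (f x - g x) powr (\<alpha> - 1) / Gamma \<alpha>)"
    by (auto simp: rl_kernel_def indicator_def fun_eq_iff)
  also have "\<dots> \<in> borel_measurable M"
    by measurable
  finally show ?thesis .
qed

text \<open>The substitution \<open>r = a + c * x\<close> with \<open>c = b - a\<close> reduces the
  claim to the Beta integral over the unit interval.\<close>

lemma has_bochner_integral_Beta_interval:
  fixes a b p q :: real
  assumes "a < b" "p > 0" "q > 0"
  shows "has_bochner_integral lborel
    (\<lambda>r. indicator {a<..<b} r * ((b - r) powr (p - 1) * (r - a) powr (q - 1)))
    (Beta p q * (b - a) powr (p + q - 1))"
proof -
  let ?f = "\<lambda>r. indicator {a<..<b} r * ((b - r) powr (p - 1) * (r - a) powr (q - 1))"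
  let ?h = "\<lambda>x. indicator {0..1} x *\<^sub>R (x powr (q - 1) * (1 - x) powr (p - 1))"
  define c where "c = b - a"
  have c: "c > 0" "b = a + c"
    using assms by (auto simp: c_def)
  have int: "set_integrable lborel {0..1} (\<lambda>x. x powr (q - 1) * (1 - x) powr (p - 1))"
    by (rule integrable_Beta) fact+
  have "integral\<^sup>L lborel ?h = Beta p q"
    using set_borel_integral_eq_integral(2)[OF int] has_integral_Beta_real[OF assms(3,2)]
    by (simp add: set_lebesgue_integral_def integral_unique Beta_commute)
  with int have "has_bochner_integral lborel ?h (Beta p q)"
    by (simp add: has_bochner_integral_iff set_integrable_def)
  then have "has_bochner_integral lborel (\<lambda>x. c powr (p + q - 2) * ?h x) (c powr (p + q - 2) * Beta p q)"
    by (rule has_bochner_integral_mult_right)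
  also have "(\<lambda>x. c powr (p + q - 2) * ?h x) = (\<lambda>x. ?f (a + c * x))"
  proof
    fix x
    show "c powr (p + q - 2) * ?h x = ?f (a + c * x)"
    proof (cases "0 < x \<and> x < 1")
      case True
      moreover have "c - c * x = c * (1 - x)" by (simp add: algebra_simps)
      ultimately show ?thesis
        using c by (simp add: powr_mult indicator_def powr_add[symmetric])
    next
      case False
      \<comment> \<open>At the endpoints the convention \<open>0 powr y = 0\<close> makes the
        integrand vanish, so the closed and the open interval agree pointwise.\<close>
      then have "x powr (q - 1) * (1 - x) powr (p - 1) = 0 \<or> x \<notin> {0..1}"
        by auto
      moreover have "\<not> (a < a + c * x \<and> a + c * x < b)"
        using False c by (simp add: zero_less_mult_iff)
      ultimately show ?thesis
        by (auto simp: indicator_def)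
    qed
  qed
  \<comment> \<open>The two powers contribute the exponent \<open>p + q - 2\<close>; the Jacobian
    \<open>c\<close> contributes the missing 1.\<close>
  also have "c powr (p + q - 2) * Beta p q = (Beta p q * (b - a) powr (p + q - 1)) /\<^sub>R \<bar>c\<bar>"
    using c powr_mult_base[of c "p + q - 2"] by (simp add: field_simps)
  finally show ?thesis
    using c by (subst lborel_has_bochner_integral_real_affine_iff[where c = c and t = a]) auto
qed

text \<open>With this normalisation the Gamma factors of the Beta integral cancel, so I^\<alpha>
  moves each term of the Mittag-Leffler series to the next one.\<close>

lemma has_bochner_integral_rl_kernel_powr:
  assumes "\<alpha> > 0" "\<beta> > -1" "t > 0"
  shows "has_bochner_integral lborel (\<lambda>s. rl_kernel \<alpha> t s * (s powr \<beta> / Gamma (\<beta> + 1)))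
    (t powr (\<beta> + \<alpha>) / Gamma (\<beta> + \<alpha> + 1))"
proof -
  have "Gamma \<alpha> \<noteq> 0" "Gamma (\<beta> + 1) \<noteq> 0"
    using assms by (auto simp: Gamma_eq_zero_iff dest: nonpos_Ints_nonpos)
  then show ?thesis
    using has_bochner_integral_mult_right[OF has_bochner_integral_Beta_interval[of 0 t \<alpha> "\<beta> + 1"],
        of "1 / (Gamma \<alpha> * Gamma (\<beta> + 1))"] assms
    by (simp add: rl_kernel_def Beta_def algebra_simps)
qed

lemma has_bochner_integral_rl_kernel:
  assumes "\<alpha> > 0" "t > 0"
  shows "has_bochner_integral lborel (rl_kernel \<alpha> t) (t powr \<alpha> / Gamma (\<alpha> + 1))"
proof -
  \<comment> \<open>Since \<open>0 powr 0 = 0\<close>, the factor \<open>s powr 0\<close> is not 1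
    at 0, but the kernel vanishes there.\<close>
  have "(\<lambda>s. rl_kernel \<alpha> t s * (s powr 0 / Gamma (0 + 1))) = rl_kernel \<alpha> t"
    by (auto simp: fun_eq_iff rl_kernel_def indicator_def)
  then show ?thesis
    using has_bochner_integral_rl_kernel_powr[of \<alpha> 0 t] assms by simp
qed

text \<open>The semigroup law of fractional integration. Orders \<alpha> and 1 - \<alpha> compose to
  order 1, whose kernel is the indicator.\<close>

lemma has_bochner_integral_rl_kernel_comp:
  assumes "\<alpha> > 0" "\<beta> > 0"
  shows "has_bochner_integral lborel (\<lambda>r. rl_kernel \<alpha> t r * rl_kernel \<beta> r s) (rl_kernel (\<alpha> + \<beta>) t s)"
proof (cases "0 < s \<and> s < t")
  case True
  have "(\<lambda>r. 1 / (Gamma \<alpha> * Gamma \<beta>) * (indicator {s<..<t} r * ((t - r) powr (\<alpha> - 1) * (r - s) powr (\<beta> - 1))))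
      = (\<lambda>r. rl_kernel \<alpha> t r * rl_kernel \<beta> r s)"
    using True by (auto simp: fun_eq_iff rl_kernel_def indicator_def)
  moreover have "1 / (Gamma \<alpha> * Gamma \<beta>) * (Beta \<alpha> \<beta> * (t - s) powr (\<alpha> + \<beta> - 1)) = rl_kernel (\<alpha> + \<beta>) t s"
    using True Gamma_real_pos[OF assms(1)] Gamma_real_pos[OF assms(2)] by (simp add: rl_kernel_def Beta_def)
  ultimately show ?thesis
    using has_bochner_integral_mult_right[OF has_bochner_integral_Beta_interval[of s t \<alpha> \<beta>],
        of "1 / (Gamma \<alpha> * Gamma \<beta>)"] True assms by simp
next
  case False
  then have "(\<lambda>r. rl_kernel \<alpha> t r * rl_kernel \<beta> r s) = (\<lambda>r. 0)"
    by (auto simp: fun_eq_iff rl_kernel_def indicator_def)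
  moreover have "rl_kernel (\<alpha> + \<beta>) t s = 0"
    using False by (simp add: rl_kernel_eq_0)
  ultimately show ?thesis
    using has_bochner_integral_zero by simp
qed

subsection \<open>From the Caputo equation to a Volterra equation\<close>

text \<open>The derivative may blow up at 0, so the interior form of the fundamental theorem is
  applied. It yields a gauge integral, which \<open>int\<close> turns into a Lebesgue
  integral.\<close>

lemma has_bochner_integral_deriv:
  fixes f :: "real \<Rightarrow> real"
  assumes "t > 0" "continuous_on {0..t} f" "\<And>s. 0 < s \<Longrightarrow> s < t \<Longrightarrow> f differentiable (at s)"
    and int: "set_integrable lborel {0<..<t} (deriv f)"
  shows "has_bochner_integral lborel (\<lambda>s. indicator {0<..<t} s * deriv f s) (f t - f 0)"
proof -
  have "(deriv f has_integral (f t - f 0)) {0..t}"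
  proof (rule fundamental_theorem_of_calculus_interior)
    show "(f has_vector_derivative deriv f s) (at s)" if "s \<in> {0<..<t}" for s
      using assms(3)[of s] that
      by (auto simp: has_real_derivative_iff_has_vector_derivative[symmetric] DERIV_deriv_iff_real_differentiable)
  qed (use assms in auto)
  then have "(deriv f has_integral (f t - f 0)) {0<..<t}"
    by (simp add: has_integral_Icc_iff_Ioo)
  then show ?thesis
    using set_borel_integral_eq_integral(2)[OF int] int
    by (simp add: has_bochner_integral_iff set_integrable_def set_lebesgue_integral_def integral_unique)
qed

lemma caputo_deriv_eq_rl_kernel:
  assumes "\<alpha> < 1"
  shows "caputo_deriv \<alpha> f t = (\<integral>s. rl_kernel (1 - \<alpha>) t s * deriv f s \<partial>lborel)"
proof -
  have "(\<integral>s. rl_kernel (1 - \<alpha>) t s * deriv f s \<partial>lborel) =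
      (\<integral>s. 1 / Gamma (1 - \<alpha>) * (indicator {0<..<t} s *\<^sub>R ((t - s) powr (- \<alpha>) * deriv f s)) \<partial>lborel)"
    by (intro Bochner_Integration.integral_cong) (auto simp: rl_kernel_def)
  then show ?thesis
    using assms by (simp add: caputo_deriv_def set_lebesgue_integral_def)
qed

text \<open>
  The weight in the Caputo integral is bounded below on \<open>{0<..<t}\<close>, so its convergence
  already forces \<open>f'\<close> to be integrable up to \<open>0\<close>.
\<close>

lemma caputo_differentiable_imp_set_integrable_deriv:
  assumes "0 < \<alpha>" "\<alpha> < 1" "caputo_differentiable \<alpha> f" "t > 0"
  shows "set_integrable lborel {0<..<t} (deriv f)"
proof -
  let ?w = "\<lambda>s. indicator {0<..<t} s *\<^sub>R ((t - s) powr (- \<alpha>) * deriv f s)"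
  have int: "integrable lborel ?w"
    using assms by (auto simp: caputo_differentiable_def set_integrable_def)
  then have [measurable]: "?w \<in> borel_measurable lborel"
    by auto
  have eq: "(\<lambda>s. indicator {0<..<t} s *\<^sub>R deriv f s) = (\<lambda>s. (t - s) powr \<alpha> * ?w s)"
    by (auto simp: fun_eq_iff powr_minus indicator_def field_simps)
  have "integrable lborel (\<lambda>s. (t - s) powr \<alpha> * ?w s)"
  proof (rule Bochner_Integration.integrable_bound)
    show "integrable lborel (\<lambda>s. t powr \<alpha> * ?w s)"
      using int by (rule integrable_mult_right)
    have "norm ((t - s) powr \<alpha> * ?w s) \<le> norm (t powr \<alpha> * ?w s)" for s
    proof (cases "s \<in> {0<..<t}")
      case True
      then have "(t - s) powr \<alpha> \<le> t powr \<alpha>"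
        using assms by (intro powr_mono2) auto
      then show ?thesis
        by (auto simp: abs_mult intro!: mult_right_mono)
    qed simp
    then show "AE s in lborel. norm ((t - s) powr \<alpha> * ?w s) \<le> norm (t powr \<alpha> * ?w s)"
      by simp
  qed measurable
  then show ?thesis
    unfolding set_integrable_def eq .
qed

text \<open>For \<alpha> < 1 the Caputo derivative is I^(1 - \<alpha>) applied to f', so applying
  I^\<alpha> gives the ordinary integral of f' by the semigroup law. For \<alpha> = 1 the order 1 -
  \<alpha> = 0 has no kernel, and the fundamental theorem applies directly.\<close>

lemma caputo_equation_imp_volterra:
  fixes f g :: "real \<Rightarrow> real"
  assumes "0 < \<alpha>" "\<alpha> \<le> 1" and f: "caputo_differentiable \<alpha> f"
    and eq: "\<And>s. s > 0 \<Longrightarrow> caputo_deriv \<alpha> f s = g s"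
    and g: "continuous_on {0..} g" and "t > 0"
  shows "has_bochner_integral lborel (\<lambda>s. rl_kernel \<alpha> t s * g s) (f t - f 0)"
proof (cases "\<alpha> = 1")
  case True
  have deriv: "deriv f s = g s" if "s > 0" for s
    using eq[OF that] True by (simp add: caputo_deriv_def)
  \<comment> \<open>Continuity of \<open>g\<close> up to 0 supplies the integrability of f' on the
    open interval.\<close>
  have "set_integrable lborel {0..t} g"
    by (intro borel_integrable_atLeastAtMost' continuous_on_subset[OF g]) auto
  then have "set_integrable lborel {0<..<t} g"
    by (rule set_integrable_subset) auto
  also have "set_integrable lborel {0<..<t} g \<longleftrightarrow> set_integrable lborel {0<..<t} (deriv f)"
    by (intro set_integrable_cong) (auto simp: deriv)
  finally have "has_bochner_integral lborel (\<lambda>s. indicator {0<..<t} s * deriv f s) (f t - f 0)"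
    using f \<open>t > 0\<close>
    by (intro has_bochner_integral_deriv)
      (auto simp: caputo_differentiable_def intro: continuous_on_subset)
  also have "(\<lambda>s. indicator {0<..<t} s * deriv f s) = (\<lambda>s. rl_kernel \<alpha> t s * g s)"
    using True by (auto simp: fun_eq_iff rl_kernel_1 indicator_def deriv)
  finally show ?thesis .
next
  case False
  with assms have \<alpha>: "0 < \<alpha>" "\<alpha> < 1" by auto
  define q where "q s = indicator {0<..<t} s * deriv f s" for s
  have q: "has_bochner_integral lborel q (f t - f 0)"
    unfolding q_def
    using f \<open>t > 0\<close> caputo_differentiable_imp_set_integrable_deriv[OF \<alpha> f \<open>t > 0\<close>]
    by (intro has_bochner_integral_deriv)
      (auto simp: caputo_differentiable_def intro: continuous_on_subset)
  then have q_int: "integrable lborel q" and [measurable]: "q \<in> borel_measurable borel"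
    by (auto simp: has_bochner_integral_iff dest: borel_measurable_integrable)
  have q_ind: "indicator {0<..<t} s * q s = q s" "indicator {0<..<t} s * norm (q s) = norm (q s)" for s
    by (simp_all add: q_def indicator_def)
  \<comment> \<open>Integrating over \<open>r\<close> first collapses the two kernels and leaves
    \<open>q s\<close>; integrating over \<open>s\<close> first produces the Caputo derivative at
    \<open>r\<close>.\<close>
  let ?F = "\<lambda>s r. rl_kernel \<alpha> t r * rl_kernel (1 - \<alpha>) r s * q s"
  have inner: "has_bochner_integral lborel (\<lambda>r. ?F s r) (q s)" for s
    using has_bochner_integral_mult_left[OF has_bochner_integral_rl_kernel_comp[of \<alpha> "1 - \<alpha>" t s], of "q s"] \<alpha>
    by (simp add: rl_kernel_1 q_ind)
  \<comment> \<open>The kernels are nonnegative, so the same collapse evaluates the integral of the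
    norm, giving the absolute integrability for Fubini.\<close>
  have inner_norm: "(\<integral>r. norm (?F s r) \<partial>lborel) = norm (q s)" for s
  proof -
    have "norm (?F s r) = rl_kernel \<alpha> t r * rl_kernel (1 - \<alpha>) r s * norm (q s)" for r
      using \<alpha> by (simp add: abs_mult rl_kernel_nonneg)
    then have "(\<integral>r. norm (?F s r) \<partial>lborel) =
        (\<integral>r. rl_kernel \<alpha> t r * rl_kernel (1 - \<alpha>) r s * norm (q s) \<partial>lborel)"
      by simp
    also have "\<dots> = rl_kernel (\<alpha> + (1 - \<alpha>)) t s * norm (q s)"
      using \<alpha>
      by (intro has_bochner_integral_integral_eq has_bochner_integral_mult_left
          has_bochner_integral_rl_kernel_comp) auto
    also have "\<dots> = norm (q s)"
      using q_ind(2) by (simp add: rl_kernel_1)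
    finally show ?thesis .
  qed
  have F: "integrable (lborel \<Otimes>\<^sub>M lborel) (case_prod ?F)"
  proof (rule lborel_pair.Fubini_integrable)
    show "integrable lborel (\<lambda>s. \<integral>r. norm (case_prod ?F (s, r)) \<partial>lborel)"
      using q_int by (simp add: inner_norm[simplified])
    show "AE s in lborel. integrable lborel (\<lambda>r. case_prod ?F (s, r))"
      using inner by (simp add: has_bochner_integral_iff)
  qed measurable
  have outer: "(\<integral>s. ?F s r \<partial>lborel) = rl_kernel \<alpha> t r * g r" for r
  proof (cases "r \<in> {0<..<t}")
    case True
    \<comment> \<open>The inner kernel already restricts \<open>s\<close> to values below
      \<open>r < t\<close>, so the cutoff in \<open>q\<close> changes nothing.\<close>
    have "(\<integral>s. ?F s r \<partial>lborel) = (\<integral>s. rl_kernel \<alpha> t r * (rl_kernel (1 - \<alpha>) r s * deriv f s) \<partial>lborel)"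
      using True by (intro Bochner_Integration.integral_cong) (auto simp: q_def rl_kernel_def indicator_def)
    also have "\<dots> = rl_kernel \<alpha> t r * caputo_deriv \<alpha> f r"
      using \<alpha> by (simp add: caputo_deriv_eq_rl_kernel)
    finally show ?thesis
      using True eq by simp
  qed (simp add: rl_kernel_eq_0)
  have "integrable lborel (\<lambda>r. \<integral>s. ?F s r \<partial>lborel)"
    by (rule lborel_pair.integrable_snd[OF F])
  moreover have "(\<integral>r. (\<integral>s. ?F s r \<partial>lborel) \<partial>lborel) = f t - f 0"
    by (simp only: lborel_pair.Fubini_integral[OF F] has_bochner_integral_integral_eq[OF inner]
        has_bochner_integral_integral_eq[OF q])
  ultimately show ?thesis
    by (simp add: outer has_bochner_integral_iff)
qed

subsection \<open>The Volterra equation solved by the Mittag-Leffler function\<close>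

text \<open>If R_K is the remainder after K terms, the equation gives R_(K+1) = I^\<alpha> (z R_K).
  The bound passes from K to K + 1 by the same shift of powers, starting from
  \<open>norm (G t) \<le> 1\<close>.\<close>

lemma volterra_partial_sum_bound:
  fixes G :: "real \<Rightarrow> complex" and z :: complex
  assumes "\<alpha> > 0" and bound: "\<And>t. t > 0 \<Longrightarrow> norm (G t) \<le> 1"
    and eq: "\<And>t. t > 0 \<Longrightarrow> has_bochner_integral lborel (\<lambda>s. rl_kernel \<alpha> t s *\<^sub>R (z * G s)) (G t - 1)"
    and "t > 0"
  shows "norm (G t - (\<Sum>k<K. z ^ k * of_real (t powr (real k * \<alpha>) / Gamma (real k * \<alpha> + 1))))
    \<le> norm z ^ K * (t powr (real K * \<alpha>) / Gamma (real K * \<alpha> + 1))"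
  using \<open>t > 0\<close>
proof (induction K arbitrary: t)
  case 0
  then show ?case using bound by simp
next
  case (Suc K)
  define e where "e k s = s powr (real k * \<alpha>) / Gamma (real k * \<alpha> + 1)" for k s
  have e: "has_bochner_integral lborel (\<lambda>s. rl_kernel \<alpha> t s * e k s) (e (Suc k) t)" for k
  proof -
    have "0 \<le> real k * \<alpha>" using \<open>\<alpha> > 0\<close> by simp
    then have "-1 < real k * \<alpha>" by linarith
    then show ?thesis
      using has_bochner_integral_rl_kernel_powr[OF \<open>\<alpha> > 0\<close> _ \<open>t > 0\<close>, of "real k * \<alpha>"]
      by (simp add: e_def distrib_right add.commute[of \<alpha>])
  qed
  let ?R = "\<lambda>s. G s - (\<Sum>k<K. z ^ k * of_real (e k s))"
  have e': "has_bochner_integral lborel (\<lambda>s. z ^ Suc k * of_real (rl_kernel \<alpha> t s * e k s))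
      (z ^ Suc k * of_real (e (Suc k) t))" for k
    by (intro has_bochner_integral_mult_right has_bochner_integral_of_real e)
  have "has_bochner_integral lborel
      (\<lambda>s. rl_kernel \<alpha> t s *\<^sub>R (z * G s) - (\<Sum>k<K. z ^ Suc k * of_real (rl_kernel \<alpha> t s * e k s)))
      (G t - 1 - (\<Sum>k<K. z ^ Suc k * of_real (e (Suc k) t)))"
    by (intro has_bochner_integral_diff has_bochner_integral_sum eq e') fact
  \<comment> \<open>The subtracted 1 is the term \<open>e 0 t\<close>; this needs
    \<open>t > 0\<close>, because \<open>0 powr 0 = 0\<close>.\<close>
  also have "G t - 1 - (\<Sum>k<K. z ^ Suc k * of_real (e (Suc k) t)) =
      G t - (\<Sum>k<Suc K. z ^ k * of_real (e k t))"
    using \<open>t > 0\<close> by (subst sum.lessThan_Suc_shift) (simp add: e_def)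
  also have "(\<lambda>s. rl_kernel \<alpha> t s *\<^sub>R (z * G s) - (\<Sum>k<K. z ^ Suc k * of_real (rl_kernel \<alpha> t s * e k s))) =
      (\<lambda>s. rl_kernel \<alpha> t s *\<^sub>R (z * ?R s))"
    by (auto simp: fun_eq_iff scaleR_conv_of_real sum_distrib_left algebra_simps)
  finally have R: "has_bochner_integral lborel (\<lambda>s. rl_kernel \<alpha> t s *\<^sub>R (z * ?R s))
      (G t - (\<Sum>k<Suc K. z ^ k * of_real (e k t)))" .
  have B: "has_bochner_integral lborel (\<lambda>s. norm z ^ Suc K * (rl_kernel \<alpha> t s * e K s))
      (norm z ^ Suc K * e (Suc K) t)"
    by (intro has_bochner_integral_mult_right e)
  have "norm (rl_kernel \<alpha> t s *\<^sub>R (z * ?R s)) \<le> norm z ^ Suc K * (rl_kernel \<alpha> t s * e K s)" for s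
  proof (cases "s \<in> {0<..<t}")
    case True
    then have "norm (?R s) \<le> norm z ^ K * e K s"
      using Suc.IH[of s] by (simp add: e_def)
    then have "rl_kernel \<alpha> t s * (norm z * norm (?R s)) \<le> rl_kernel \<alpha> t s * (norm z * (norm z ^ K * e K s))"
      using \<open>\<alpha> > 0\<close> by (intro mult_left_mono rl_kernel_nonneg) auto
    then show ?thesis
      using \<open>\<alpha> > 0\<close> by (simp add: norm_mult rl_kernel_nonneg mult_ac)
  qed (simp add: rl_kernel_eq_0)
  then have "norm (\<integral>s. rl_kernel \<alpha> t s *\<^sub>R (z * ?R s) \<partial>lborel)
      \<le> (\<integral>s. norm z ^ Suc K * (rl_kernel \<alpha> t s * e K s) \<partial>lborel)"
    using R B by (intro Bochner_Integration.integral_norm_bound_integral) (auto simp: has_bochner_integral_iff)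
  then show ?case
    using R B by (simp add: has_bochner_integral_iff e_def)
qed

text \<open>The vanishing remainder shows at once that the series converges and that its sum is
  \<open>G t\<close>.\<close>

lemma volterra_solution_eq_mittag_leffler:
  fixes G :: "real \<Rightarrow> complex" and z :: complex
  assumes "\<alpha> > 0" and "\<And>t. t > 0 \<Longrightarrow> norm (G t) \<le> 1"
    and "\<And>t. t > 0 \<Longrightarrow> has_bochner_integral lborel (\<lambda>s. rl_kernel \<alpha> t s *\<^sub>R (z * G s)) (G t - 1)"
    and "t > 0"
  shows "G t = mittag_leffler \<alpha> 1 (z * of_real (t powr \<alpha>))"
proof -
  let ?x = "z * complex_of_real (t powr \<alpha>)"
  have pow: "t powr (real k * \<alpha>) = (t powr \<alpha>) ^ k" for k
    using \<open>t > 0\<close> by (simp add: mult.commute[of _ \<alpha>] powr_powr[symmetric] powr_realpow)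
  have "(\<lambda>K. norm (G t - (\<Sum>k<K. ?x ^ k / of_real (Gamma (of_nat k * \<alpha> + 1))))) \<longlonglongrightarrow> 0"
  proof (rule Lim_null_comparison)
    show "(\<lambda>K. (norm z * t powr \<alpha>) ^ K / Gamma (real K * \<alpha> + 1)) \<longlonglongrightarrow> 0"
      using assms by (intro power_over_Gamma_tendsto_0) auto
    show "\<forall>\<^sub>F K in sequentially. norm (norm (G t - (\<Sum>k<K. ?x ^ k / of_real (Gamma (of_nat k * \<alpha> + 1)))))
        \<le> (norm z * t powr \<alpha>) ^ K / Gamma (real K * \<alpha> + 1)"
      using volterra_partial_sum_bound[OF assms]
      by (intro always_eventually allI) (simp add: pow power_mult_distrib)
  qed
  then have "(\<lambda>k. ?x ^ k / of_real (Gamma (of_nat k * \<alpha> + 1))) sums G t"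
    unfolding sums_def by (subst tendsto_dist_iff) (simp add: dist_norm norm_minus_commute)
  then show ?thesis
    by (simp add: mittag_leffler_def sums_iff)
qed

subsection \<open>Probability generating functions\<close>

text \<open>Dominated convergence applied to partial sums. It serves both to expand expectations
  over states and to exchange the sum over states with the time integral.\<close>

lemma sums_integral_dominated:
  fixes f :: "nat \<Rightarrow> 'a \<Rightarrow> 'b :: {banach, second_countable_topology}"
  assumes [measurable]: "\<And>n. f n \<in> borel_measurable M" and w: "integrable M w"
    and sums: "\<And>x. x \<in> space M \<Longrightarrow> (\<lambda>n. f n x) sums g x"
    and bound: "\<And>n x. x \<in> space M \<Longrightarrow> norm (\<Sum>k<n. f k x) \<le> w x"
    and int: "\<And>n. integrable M (f n)"
  shows "integrable M g" "(\<lambda>n. integral\<^sup>L M (f n)) sums integral\<^sup>L M g"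
proof -
  have lim: "(\<lambda>n. \<Sum>k<n. f k x) \<longlonglongrightarrow> g x" if "x \<in> space M" for x
    using sums[OF that] by (simp add: sums_def)
  have [measurable]: "g \<in> borel_measurable M"
    by (rule borel_measurable_LIMSEQ_metric[OF _ lim]) auto
  note dom = _ _ w AE_I2[OF lim] AE_I2[OF bound]
  show "integrable M g"
    by (rule integrable_dominated_convergence[OF dom]) auto
  have "(\<lambda>n. \<integral>x. (\<Sum>k<n. f k x) \<partial>M) \<longlonglongrightarrow> integral\<^sup>L M g"
    by (rule integral_dominated_convergence[OF dom]) auto
  then show "(\<lambda>n. integral\<^sup>L M (f n)) sums integral\<^sup>L M g"
    using int by (simp add: sums_def)
qed

lemma (in prob_space) sums_expectation_discrete:
  fixes h :: "nat \<Rightarrow> 'b :: {banach, second_countable_topology}"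
  assumes X [measurable]: "X \<in> measurable M (count_space UNIV)" and h: "\<And>n. norm (h n) \<le> 1"
  shows "(\<lambda>n. prob {\<omega> \<in> space M. X \<omega> = n} *\<^sub>R h n) sums (\<integral>\<omega>. h (X \<omega>) \<partial>M)"
proof -
  let ?A = "\<lambda>n. {\<omega> \<in> space M. X \<omega> = n}"
  have [measurable]: "?A n \<in> sets M" for n
    by measurable
  have "(\<lambda>n. \<integral>\<omega>. indicator (?A n) \<omega> *\<^sub>R h n \<partial>M) sums (\<integral>\<omega>. h (X \<omega>) \<partial>M)"
  proof (rule sums_integral_dominated(2))
    show "integrable M (\<lambda>_. 1 :: real)"
      by simp
    fix \<omega> assume \<omega>: "\<omega> \<in> space M"
    \<comment> \<open>At each outcome a single term survives, so every partial sum is 0 or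
      \<open>h (X \<omega>)\<close> and the constant 1 dominates.\<close>
    have eq: "(\<lambda>n. indicator (?A n) \<omega> *\<^sub>R h n) = (\<lambda>n. if n = X \<omega> then h n else 0)"
      using \<omega> by (auto simp: fun_eq_iff)
    show "(\<lambda>n. indicator (?A n) \<omega> *\<^sub>R h n) sums h (X \<omega>)"
      unfolding eq by (rule sums_single)
    show "norm (\<Sum>k<n. indicator (?A k) \<omega> *\<^sub>R h k) \<le> 1" for n
      unfolding fun_cong[OF eq] using h by (simp add: sum.delta)
  qed (auto simp: emeasure_eq_measure)
  moreover have "(\<integral>\<omega>. indicator (?A n) \<omega> *\<^sub>R h n \<partial>M) = prob (?A n) *\<^sub>R h n" for n
    by (subst integral_scaleR_left) (auto simp: emeasure_eq_measure)
  ultimately show ?thesis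
    by simp
qed

lemma (in prob_space) norm_prob_gen_fun_le_1:
  assumes "norm u \<le> 1"
  shows "norm (prob_gen_fun M X u) \<le> 1"
proof (cases "integrable M (\<lambda>\<omega>. u ^ X \<omega>)")
  case True
  have "norm (prob_gen_fun M X u) \<le> (\<integral>\<omega>. norm (u ^ X \<omega>) \<partial>M)"
    unfolding prob_gen_fun_def by (rule integral_norm_bound)
  also have "\<dots> \<le> (\<integral>\<omega>. 1 \<partial>M)"
    using assms by (intro integral_mono integrable_norm True) (simp_all add: norm_power power_le_one)
  finally show ?thesis by (simp add: prob_space)
\<comment> \<open>A non-integrable function has Bochner integral 0 by convention.\<close>
qed (simp add: prob_gen_fun_def not_integrable_integral_eq)

lemma norm_power_mult_of_real_le:
  fixes u :: complex
  assumes "norm u \<le> 1"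
  shows "norm (u ^ n * of_real x) \<le> \<bar>x\<bar>"
  unfolding norm_mult norm_of_real norm_power
  using assms by (intro mult_left_le_one_le power_le_one) auto

subsection \<open>The convoluted fractional Poisson process\<close>

text \<open>Outside the indices 0 to n one of the two factors vanishes.\<close>

lemma discrete_conv_nonneg_support:
  assumes "\<And>j. j < 0 \<Longrightarrow> a j = 0" "\<And>j. j < 0 \<Longrightarrow> b j = 0"
  shows "discrete_conv a b (int n) = (\<Sum>j\<le>n. a (int j) * b (int (n - j)))"
proof -
  have "discrete_conv a b (int n) = (\<Sum>\<^sub>\<infinity>j\<in>int ` {..n}. a j * b (int n - j))"
    unfolding discrete_conv_def
  proof (rule infsum_cong_neutral)
    fix j assume j: "j \<in> UNIV - int ` {..n}"
    have "j < 0 \<or> int n - j < 0"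
    proof (rule ccontr)
      assume "\<not> ?thesis"
      then have "j = int (nat j)" "nat j \<le> n" by auto
      with j show False by blast
    qed
    then show "a j * b (int n - j) = 0"
      using assms by auto
  qed auto
  also have "\<dots> = (\<Sum>j\<le>n. a (int j) * b (int (n - j)))"
    by (simp add: sum.reindex of_nat_diff)
  finally show ?thesis .
qed

text \<open>Moving the shift onto the first sequence lets both convolutions of the governing
  equation be merged term by term.\<close>

lemma discrete_conv_shift: "discrete_conv a b (n - 1) = discrete_conv (\<lambda>j. a (j - 1)) b n"
proof -
  have "bij_betw (\<lambda>j::int. j - 1) UNIV UNIV"
    by (rule bij_betwI[where g = "\<lambda>j. j + 1"]) auto
  from infsum_reindex_bij_betw[OF this, of "\<lambda>j. a j * b (n - 1 - j)"] show ?thesis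
    by (simp add: discrete_conv_def)
qed

context intensity_parameters
begin

text \<open>These are the coefficients of the merged equation: \<open>jump 0 = - lam 0\<close>, as
  \<open>lam (- 1) = 0\<close>, and all later ones are nonnegative.\<close>

definition jump :: "nat \<Rightarrow> real" where
  "jump j = lam (int j - 1) - lam (int j)"

text \<open>Past the negative term at index 0, monotonicity of \<open>lam\<close> lets the absolute
  values telescope to \<open>lam 0 - lam n\<close>, which is at most \<open>lam 0\<close>.\<close>

lemma summable_norm_jump: "summable (\<lambda>j. norm (jump j))"
proof (subst summable_Suc_iff[symmetric], rule summableI_nonneg_bounded)
  fix n
  have "norm (jump (Suc j)) = lam (int j) - lam (int (Suc j))" for j
    using lam_decreasing[of "int j" "int (Suc j)"] by (simp add: jump_def)
  then have "(\<Sum>j<n. norm (jump (Suc j))) = lam 0 - lam (int n)"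
    by (simp only: sum_lessThan_telescope'[of "\<lambda>j. lam (int j)"]) simp
  moreover have "lam (int n) \<ge> 0"
    using lam_0 lam_pos[of "int n"] by (cases "n = 0") auto
  ultimately show "(\<Sum>j<n. norm (jump (Suc j))) \<le> lam 0"
    by simp
qed simp

end

context convoluted_fractional_poisson
begin

abbreviation p :: "nat \<Rightarrow> real \<Rightarrow> real" where
  "p n \<equiv> state_prob M N (int n)"

lemma governing_jump:
  assumes "t > 0"
  shows "caputo_deriv \<alpha> (p n) t = (\<Sum>j\<le>n. jump j * p (n - j) t)"
proof -
  have neg: "state_prob M N m t = 0" if "m < 0" for m
  proof -
    have "{\<omega> \<in> space M. int (N t \<omega>) = m} = {}" using that by auto
    then show ?thesis unfolding state_prob_def by (simp only: measure_empty)
  qed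
  have "caputo_deriv \<alpha> (p n) t =
      - discrete_conv lam (\<lambda>m. state_prob M N m t) (int n)
      + discrete_conv (\<lambda>j. lam (j - 1)) (\<lambda>m. state_prob M N m t) (int n)"
    using governing[of "int n" t] assms by (simp add: discrete_conv_shift)
  then show ?thesis
    by (simp add: discrete_conv_nonneg_support neg lam_neg jump_def left_diff_distrib sum_subtractf)
qed

lemma volterra:
  assumes "0 < \<alpha>" "\<alpha> \<le> 1" "t > 0"
  shows "has_bochner_integral lborel (\<lambda>s. rl_kernel \<alpha> t s * (\<Sum>j\<le>n. jump j * p (n - j) s))
    (p n t - p n 0)"
proof (rule caputo_equation_imp_volterra)
  show "continuous_on {0..} (\<lambda>s. \<Sum>j\<le>n. jump j * p (n - j) s)"
    using differentiable by (intro continuous_intros) (auto simp: caputo_differentiable_def)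
qed (use assms differentiable governing_jump in auto)

lemma sums_state_prob:
  fixes h :: "nat \<Rightarrow> 'b :: {banach, second_countable_topology}"
  assumes "t \<ge> 0" "\<And>n. norm (h n) \<le> 1"
  shows "(\<lambda>n. p n t *\<^sub>R h n) sums (\<integral>\<omega>. h (N t \<omega>) \<partial>M)"
  using sums_expectation_discrete[OF measurable_N[OF assms(1)] assms(2)]
  by (simp add: state_prob_def)

lemma sums_prob_gen_fun:
  assumes "t \<ge> 0" "norm u \<le> 1"
  shows "(\<lambda>n. p n t *\<^sub>R u ^ n) sums prob_gen_fun M (N t) u"
  unfolding prob_gen_fun_def using assms
  by (intro sums_state_prob) (auto simp: norm_power power_le_one)

lemma sums_p: "t \<ge> 0 \<Longrightarrow> (\<lambda>n. p n t) sums 1"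
  using sums_state_prob[of t "\<lambda>_. 1 :: real"] by (simp add: prob_space)

lemma p_nonneg: "0 \<le> state_prob M N m t"
  by (simp add: state_prob_def)

lemma p_0: "p n 0 = (if n = 0 then 1 else 0)"
  using initial_0 initial_pos[of "int n"] by simp

lemma prob_gen_fun_0: "norm u \<le> 1 \<Longrightarrow> prob_gen_fun M (N 0) u = 1"
proof -
  assume "norm u \<le> 1"
  from sums_prob_gen_fun[OF order_refl this]
  have "(\<lambda>n. p n 0 *\<^sub>R u ^ n) sums prob_gen_fun M (N 0) u" .
  also have "(\<lambda>n. p n 0 *\<^sub>R u ^ n) = (\<lambda>n. if n = 0 then u ^ n else 0)"
    by (auto simp: p_0)
  finally show ?thesis
    using sums_single[of 0 "\<lambda>n. u ^ n"] by (simp add: sums_iff)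
qed

text \<open>This is the constant \<open>z\<close> of the Volterra equation for the generating
  function.\<close>

definition jump_gf :: "complex \<Rightarrow> complex" where
  "jump_gf u = (\<Sum>j. u ^ j * of_real (jump j))"

lemma summable_norm_jump_gf:
  assumes "norm u \<le> 1"
  shows "summable (\<lambda>j. norm (u ^ j * complex_of_real (jump j)))"
  by (rule summable_comparison_test'[OF summable_norm_jump, of 0])
    (simp add: norm_power_mult_of_real_le[OF assms])

text \<open>A Cauchy product: both factors converge absolutely for \<open>norm u \<le> 1\<close>, by
  summability of the jumps and of the probabilities.\<close>

lemma sums_conv_jump:
  assumes "s \<ge> 0" "norm u \<le> 1"
  shows "(\<lambda>n. u ^ n * of_real (\<Sum>j\<le>n. jump j * p (n - j) s)) sums (jump_gf u * prob_gen_fun M (N s) u)"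
proof -
  have "summable (\<lambda>n. norm (u ^ n * of_real (p n s)))"
  proof (rule summable_comparison_test'[OF sums_summable[OF sums_p[OF assms(1)]], of 0])
    show "norm (norm (u ^ n * of_real (p n s))) \<le> p n s" for n
      using norm_power_mult_of_real_le[OF assms(2), of n "p n s"] by (simp add: p_nonneg)
  qed
  from Cauchy_product_sums[OF summable_norm_jump_gf[OF assms(2)] this]
  have "(\<lambda>n. \<Sum>j\<le>n. u ^ j * of_real (jump j) * (u ^ (n - j) * of_real (p (n - j) s)))
      sums (jump_gf u * (\<Sum>n. u ^ n * of_real (p n s)))"
    by (simp add: jump_gf_def)
  also have "(\<Sum>n. u ^ n * of_real (p n s)) = prob_gen_fun M (N s) u"
    using sums_prob_gen_fun[OF assms] by (simp add: sums_iff scaleR_conv_of_real mult.commute)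
  also have "(\<lambda>n. \<Sum>j\<le>n. u ^ j * of_real (jump j) * (u ^ (n - j) * of_real (p (n - j) s))) =
      (\<lambda>n. u ^ n * complex_of_real (\<Sum>j\<le>n. jump j * p (n - j) s))"
  proof
    fix n
    have "u ^ j * of_real (jump j) * (u ^ (n - j) * of_real (p (n - j) s)) =
        u ^ n * complex_of_real (jump j * p (n - j) s)" if "j \<le> n" for j
    proof -
      have "u ^ n = u ^ j * u ^ (n - j)"
        using that by (simp add: power_add[symmetric])
      then show ?thesis by simp
    qed
    then have "(\<Sum>j\<le>n. u ^ j * of_real (jump j) * (u ^ (n - j) * of_real (p (n - j) s))) =
        (\<Sum>j\<le>n. u ^ n * complex_of_real (jump j * p (n - j) s))"
      by (intro sum.cong) auto
    then show "(\<Sum>j\<le>n. u ^ j * of_real (jump j) * (u ^ (n - j) * of_real (p (n - j) s))) =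
        u ^ n * complex_of_real (\<Sum>j\<le>n. jump j * p (n - j) s)"
      by (simp only: of_real_sum sum_distrib_left)
  qed
  finally show ?thesis .
qed

text \<open>The Cauchy product of the absolute jumps with the probabilities, which sum to 1, gives a
  bound independent of \<open>s\<close> and \<open>m\<close>, as dominated convergence in time
  requires.\<close>

lemma partial_sums_conv_jump_le:
  assumes "s \<ge> 0" "norm u \<le> 1"
  shows "norm (\<Sum>n<m. u ^ n * complex_of_real (\<Sum>j\<le>n. jump j * p (n - j) s)) \<le> (\<Sum>j. norm (jump j))"
proof -
  have "summable (\<lambda>n. norm (p n s))"
    using sums_p[OF assms(1)] p_nonneg by (simp add: sums_iff)
  then have S: "(\<lambda>n. \<Sum>j\<le>n. norm (jump j) * p (n - j) s) sums (\<Sum>j. norm (jump j))"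
    using Cauchy_product_sums[of "\<lambda>j. norm (jump j)" "\<lambda>n. p n s"] summable_norm_jump sums_p[OF assms(1)]
    by (simp add: sums_iff)
  have "norm (u ^ n * complex_of_real (\<Sum>j\<le>n. jump j * p (n - j) s)) \<le> (\<Sum>j\<le>n. norm (jump j) * p (n - j) s)" for n
  proof -
    have "norm (u ^ n * complex_of_real (\<Sum>j\<le>n. jump j * p (n - j) s)) \<le> \<bar>\<Sum>j\<le>n. jump j * p (n - j) s\<bar>"
      by (rule norm_power_mult_of_real_le) fact
    also have "\<dots> \<le> (\<Sum>j\<le>n. \<bar>jump j * p (n - j) s\<bar>)"
      by (rule sum_abs)
    finally show ?thesis
      by (simp add: abs_mult p_nonneg)
  qed
  then have "norm (\<Sum>n<m. u ^ n * complex_of_real (\<Sum>j\<le>n. jump j * p (n - j) s))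
      \<le> (\<Sum>n<m. \<Sum>j\<le>n. norm (jump j) * p (n - j) s)"
    by (intro sum_norm_le)
  also have "\<dots> \<le> (\<Sum>j. norm (jump j))"
    unfolding sums_unique[OF S]
    by (intro sum_le_suminf sums_summable[OF S] sum_nonneg mult_nonneg_nonneg p_nonneg) auto
  finally show ?thesis .
qed

text \<open>Multiply the Volterra equation of state n by \<open>u ^ n\<close> and sum over n. The
  kernel times the total absolute jump dominates the partial sums.\<close>

lemma prob_gen_fun_volterra:
  assumes "0 < \<alpha>" "\<alpha> \<le> 1" "norm u \<le> 1" "t > 0"
  shows "has_bochner_integral lborel (\<lambda>s. rl_kernel \<alpha> t s *\<^sub>R (jump_gf u * prob_gen_fun M (N s) u))
    (prob_gen_fun M (N t) u - 1)"
proof -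
  let ?G = "\<lambda>s. prob_gen_fun M (N s) u"
  let ?g = "\<lambda>n s. \<Sum>j\<le>n. jump j * p (n - j) s"
  let ?f = "\<lambda>n s. rl_kernel \<alpha> t s *\<^sub>R (u ^ n * complex_of_real (?g n s))"
  have f: "has_bochner_integral lborel (?f n) (u ^ n * of_real (p n t - p n 0))" for n
  proof -
    have "?f n = (\<lambda>s. u ^ n * of_real (rl_kernel \<alpha> t s * ?g n s))"
      by (auto simp: fun_eq_iff scaleR_conv_of_real mult_ac)
    then show ?thesis
      using has_bochner_integral_mult_right[OF has_bochner_integral_of_real[OF volterra[OF assms(1,2,4)]]]
      by simp
  qed
  have w: "integrable lborel (\<lambda>s. rl_kernel \<alpha> t s * (\<Sum>j. norm (jump j)))"
    using has_bochner_integral_rl_kernel[OF assms(1,4)] by (auto simp: has_bochner_integral_iff)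
  have sums: "(\<lambda>n. ?f n s) sums (rl_kernel \<alpha> t s *\<^sub>R (jump_gf u * ?G s))" for s
  proof (cases "s \<in> {0<..<t}")
    case True
    then show ?thesis
      using assms by (intro sums_scaleR_right sums_conv_jump) auto
  qed (simp add: rl_kernel_eq_0)
  have bound: "norm (\<Sum>k<n. ?f k s) \<le> rl_kernel \<alpha> t s * (\<Sum>j. norm (jump j))" for n s
  proof (cases "s \<in> {0<..<t}")
    case True
    then show ?thesis
      unfolding scaleR_sum_right[symmetric] norm_scaleR
      using assms rl_kernel_nonneg[OF assms(1)] by (simp only: abs_of_nonneg)
        (intro mult_left_mono partial_sums_conv_jump_le, auto)
  qed (simp add: rl_kernel_eq_0)
  note dom = sums_integral_dominated[OF borel_measurable_has_bochner_integral[OF f] w sums bound integrable.intros[OF f]]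
  have "integrable lborel (\<lambda>s. rl_kernel \<alpha> t s *\<^sub>R (jump_gf u * ?G s))"
    by (rule dom(1))
  moreover have "(\<lambda>n. integral\<^sup>L lborel (?f n)) sums (\<integral>s. rl_kernel \<alpha> t s *\<^sub>R (jump_gf u * ?G s) \<partial>lborel)"
    by (rule dom(2))
  \<comment> \<open>The same integrals, evaluated by the state equations, sum to the increment of
    the generating function from its value 1 at time 0; uniqueness of limits then identifies the two
    sums.\<close>
  moreover have "(\<lambda>n. integral\<^sup>L lborel (?f n)) sums (?G t - 1)"
  proof -
    have "(\<lambda>n. p n t *\<^sub>R u ^ n - p n 0 *\<^sub>R u ^ n) sums (?G t - ?G 0)"
      using assms by (intro sums_diff sums_prob_gen_fun) auto
    also have "(\<lambda>n. p n t *\<^sub>R u ^ n - p n 0 *\<^sub>R u ^ n) = (\<lambda>n. integral\<^sup>L lborel (?f n))"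
      using f by (auto simp: has_bochner_integral_iff fun_eq_iff scaleR_conv_of_real algebra_simps)
    finally show ?thesis
      using assms by (simp add: prob_gen_fun_0)
  qed
  ultimately show ?thesis
    by (auto simp: has_bochner_integral_iff dest: sums_unique2)
qed

end

theorem proposition3p2:
  fixes M :: "'a measure" and lam :: "int \<Rightarrow> real" and \<alpha> :: real
    and N :: "real \<Rightarrow> 'a \<Rightarrow> nat" and u :: complex and t :: real
  assumes "0 < \<alpha>" and "\<alpha> \<le> 1"
    and "convoluted_fractional_poisson M lam \<alpha> N"
    and "t \<ge> 0" and "norm u \<le> 1"
  shows "prob_gen_fun M (N t) u =
    mittag_leffler \<alpha> 1
      (\<Sum>j. u ^ j * of_real (lam (int j - 1) - lam (int j)) * of_real (t powr \<alpha>))"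
proof -
  interpret convoluted_fractional_poisson M lam \<alpha> N by fact
  have "(\<Sum>j. u ^ j * of_real (lam (int j - 1) - lam (int j)) * of_real (t powr \<alpha>)) =
      jump_gf u * of_real (t powr \<alpha>)"
    unfolding jump_gf_def jump_def[symmetric]
    by (rule suminf_mult2[symmetric], rule summable_norm_cancel, rule summable_norm_jump_gf) fact
  moreover have "prob_gen_fun M (N t) u = mittag_leffler \<alpha> 1 (jump_gf u * of_real (t powr \<alpha>))"
  proof (cases "t = 0")
    case True
    \<comment> \<open>The Volterra equation covers only \<open>t > 0\<close>. At 0 the argument is
      0, as \<open>0 powr \<alpha> = 0\<close>, and only the term k = 0 survives, by
      \<open>0 ^ 0 = 1\<close>.\<close>
    have "(\<lambda>k. 0 ^ k / complex_of_real (Gamma (of_nat k * \<alpha> + 1))) = (\<lambda>k. if k = 0 then 1 else 0)"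
      by (auto simp: fun_eq_iff)
    then have "mittag_leffler \<alpha> 1 0 = 1"
      using sums_unique[OF sums_single[of 0 "\<lambda>_. 1 :: complex"]] by (simp add: mittag_leffler_def)
    then show ?thesis
      using assms True by (simp add: prob_gen_fun_0)
  next
    case False
    then show ?thesis
      using assms
      by (intro volterra_solution_eq_mittag_leffler[where G = "\<lambda>s. prob_gen_fun M (N s) u"]
          prob_gen_fun_volterra norm_prob_gen_fun_le_1) auto
  qed
  ultimately show ?thesis by simp
qed

end
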